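(* Let $A,B,H,K$ be any logically independent events. A probability assessment $\mathcal{P}=(x,y,z)$ on the family of conditional events $\mathcal{F}=\{A|H,\ (B|K)|_{dF}(A|H),\ (A|H)\wedge_{K}(B|K)\}$ is coherent if and only if $(x,y)\in[0,1]^2$ and $z\in[z',z'']$, where $z'=0$ and $z''=xy$.
   Context: Events are two-valued entities (true/false), identified with their indicators (values $1/0$). $\emptyset$ is the impossible event; $AB$ denotes $A\wedge B$; $\overline{A}$ is the negation of $A$. Four events are logically independent if all $16$ conjunctions obtained by taking each event or its negation are different from $\emptyset$. For events $E,H$ with $H\neq\emptyset$, the conditional event $E|H$ is true if $EH$ is true, false if $\overline{E}H$ is true, void if $\overline{H}$ is true. Coherence: a real vector $\mathcal{P}=(p_1,\dots,p_n)$, with $p_j=P(E_j|H_j)$, on $\mathcal{F}=\{E_1|H_1,\dots,E_n|H_n\}$ is coherent iff for every nonempty $J\subseteq\{1,\dots,n\}$ and all real numbers $s_j$ ($j\in J$), the random gain $G=\sum_{j\in J}s_jH_j(E_j-p_j)$, restricted to the cases where $\bigvee_{j\in J}H_j$ is true, satisfies $\min G\le 0\le\max G$. De Finetti iterated conditional: $(B|K)|_{dF}(A|H)=B|(AHK)$ (a conditional event). Kleene–Lukasiewicz–Heyting–de Finetti conjunction: $(A|H)\wedge_{K}(B|K)=AHBK|(HK\vee\overline{A}H\vee\overline{B}K)$ (a conditional event; the subscript $K$ in $\wedge_K$ is only a name, unrelated to the event $K$). *)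

theory Defs
  imports Complex_Main "HOL-Library.Indicator_Function"
begin

text \<open>
  Events are sets of possible worlds: the impossible event is the empty set, the sure event is
  the whole type, and conjunction, disjunction and negation are intersection, union and complement.
\<close>

type_synonym 'w event = "'w set"

definition logically_independent4 :: "'w event \<Rightarrow> 'w event \<Rightarrow> 'w event \<Rightarrow> 'w event \<Rightarrow> bool" where
  "logically_independent4 A B H K \<longleftrightarrow>
     (\<forall>A' \<in> {A, - A}. \<forall>B' \<in> {B, - B}. \<forall>H' \<in> {H, - H}. \<forall>K' \<in> {K, - K}.
        A' \<inter> B' \<inter> H' \<inter> K' \<noteq> {})"

text \<open>
  \<open>Cond E H\<close> is the conditional event E|H. The datatype does not enforce that H is possible;
  the definition of coherence does.
\<close>

datatype 'w cond_event = Cond (conseq: "'w event") (antec: "'w event")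

text \<open>\<open>iter_dF (Cond B K) (Cond A H)\<close> is (B|K) given (A|H), in this order.\<close>

fun iter_dF :: "'w cond_event \<Rightarrow> 'w cond_event \<Rightarrow> 'w cond_event" where
  "iter_dF (Cond B K) (Cond A H) = Cond B (A \<inter> H \<inter> K)"

fun conj_K :: "'w cond_event \<Rightarrow> 'w cond_event \<Rightarrow> 'w cond_event" where
  "conj_K (Cond A H) (Cond B K) =
     Cond (A \<inter> H \<inter> B \<inter> K) ((H \<inter> K) \<union> (- A \<inter> H) \<union> (- B \<inter> K))"

definition gain ::
  "'w cond_event list \<Rightarrow> real list \<Rightarrow> nat set \<Rightarrow> (nat \<Rightarrow> real) \<Rightarrow> 'w \<Rightarrow> real" where
  "gain F P J s w =
     (\<Sum>j\<in>J. s j * indicator (antec (F ! j)) w * (indicator (conseq (F ! j)) w - P ! j))"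

text \<open>
  Families and assessments are lists of equal length, indexed from 0. The gain is determined by
  the truth values of finitely many events, so its set of values on the (nonempty) disjunction of
  the conditioning events is finite and nonempty, and \<open>Min\<close> and \<open>Max\<close> are meaningful.
\<close>

definition coherent :: "'w cond_event list \<Rightarrow> real list \<Rightarrow> bool" where
  "coherent F P \<longleftrightarrow>
     length P = length F \<and>
     (\<forall>j < length F. antec (F ! j) \<noteq> {}) \<and>
     (\<forall>J s. J \<noteq> {} \<and> J \<subseteq> {..<length F} \<longrightarrow>
        Min (gain F P J s ` (\<Union>j\<in>J. antec (F ! j))) \<le> 0 \<and>
        0 \<le> Max (gain F P J s ` (\<Union>j\<in>J. antec (F ! j))))"

end

theory Submission
  imports Defs
begin

text \<open>
  Coherence says that no system of bets has a gain that is negative in every world where some bet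
  is on (\<open>coherent_iff_no_sure_loss\<close>; the bound on the minimum is the same condition with all
  stakes reversed). The gain is bilinear in the stakes and in the distribution over worlds, so
  the two directions are dual.

  Each bound that coherence imposes comes from one system of bets whose gain would be negative
  throughout if the bound failed (\<open>bounds_if_coherent\<close>). The product bound comes from
  the factorisation \<open>a * b - x * y = y * (a - x) + a * (b - y)\<close>: on HK,
  betting for the conjunction with unit stake, against A|H with stake y and against the
  iterated conditional with unit stake yields exactly \<open>x * y - z\<close>. In the worlds of AH outside K
  the conjunction and the iterated conditional are called off. The gain there is
  \<open>- y * (1 - x)\<close>, which need not be negative. A slightly larger stake against A|H repairs this
  if \<open>x < 1\<close>. For \<open>x = 1\<close> the bet on A|H is dropped, and these worlds no longer count because
  every remaining bet is called off there.

  For the converse, a probability distribution (up to scale) on worlds where some bet is on,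
  under which every single bet is fair, excludes a sure loss (\<open>no_sure_loss_if_fair_mixture\<close>).
  Take one world in each of AHBK, AH(not B)K, (not A)H, with weights \<open>x * y\<close>, \<open>x * (1 - y)\<close>,
  \<open>1 - x\<close>. They make the bets on A|H and on the iterated conditional fair, and the conjunction
  has weight \<open>x * y\<close>. A world in (not H)(not B)K affects only the bet on the conjunction, where
  it counts as a loss; weight placed on it lowers the conditional probability of the
  conjunction from \<open>x * y\<close> to any smaller positive value, and that world alone gives the value 0.
\<close>

section \<open>Coherence as absence of a sure loss\<close>

lemma finite_gain_image:
  assumes "finite J"
  shows "finite (gain F P J s ` S)"
  using assms
proof (induction J rule: finite_induct)
  case empty
  have "gain F P {} s ` S \<subseteq> {0}"
    by (auto simp: gain_def)
  then show ?case
    by (rule finite_subset) simp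
next
  case (insert j J)
  let ?V = "{0, s j * (1 - P ! j), s j * (0 - P ! j)}"
  have "gain F P (insert j J) s w \<in> (\<lambda>(a, b). a + b) ` (?V \<times> (gain F P J s ` S))"
    if "w \<in> S" for w
  proof -
    have "gain F P (insert j J) s w =
        s j * indicator (antec (F ! j)) w * (indicator (conseq (F ! j)) w - P ! j) + gain F P J s w"
      using insert.hyps by (simp add: gain_def)
    moreover have "s j * indicator (antec (F ! j)) w * (indicator (conseq (F ! j)) w - P ! j) \<in> ?V"
      by (auto simp: indicator_def)
    ultimately show ?thesis
      using that by force
  qed
  then have "gain F P (insert j J) s ` S \<subseteq> (\<lambda>(a, b). a + b) ` (?V \<times> (gain F P J s ` S))"
    by blast
  then show ?case
    by (rule finite_subset) (use insert.IH in simp)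
qed

lemma gain_uminus: "gain F P J (\<lambda>j. - s j) w = - gain F P J s w"
  by (simp add: gain_def sum_negf)

text \<open>
  The gain takes finitely many values, so the bounds on its extrema amount to the existence of a
  world with nonnegative gain and one with nonpositive gain. The latter is the former for the
  opposite stakes.
\<close>

lemma coherent_iff_no_sure_loss:
  "coherent F P \<longleftrightarrow>
     length P = length F \<and>
     (\<forall>j < length F. antec (F ! j) \<noteq> {}) \<and>
     (\<forall>J s. J \<noteq> {} \<and> J \<subseteq> {..<length F} \<longrightarrow>
        (\<exists>w \<in> (\<Union>j\<in>J. antec (F ! j)). 0 \<le> gain F P J s w))"
proof -
  have extrema:
    "Min (gain F P J s ` U) \<le> 0 \<longleftrightarrow> (\<exists>w\<in>U. 0 \<le> gain F P J (\<lambda>j. - s j) w)"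
    "0 \<le> Max (gain F P J s ` U) \<longleftrightarrow> (\<exists>w\<in>U. 0 \<le> gain F P J s w)"
    if "U = (\<Union>j\<in>J. antec (F ! j))" "J \<noteq> {}" "J \<subseteq> {..<length F}"
      "\<forall>j < length F. antec (F ! j) \<noteq> {}" for J s U
  proof -
    have "finite J"
      using that finite_subset by blast
    then have fin: "finite (gain F P J s ` U)"
      by (rule finite_gain_image)
    have ne: "gain F P J s ` U \<noteq> {}"
      using that by auto
    show "Min (gain F P J s ` U) \<le> 0 \<longleftrightarrow> (\<exists>w\<in>U. 0 \<le> gain F P J (\<lambda>j. - s j) w)"
      using Min_le_iff[OF fin ne] by (simp add: gain_uminus)
    show "0 \<le> Max (gain F P J s ` U) \<longleftrightarrow> (\<exists>w\<in>U. 0 \<le> gain F P J s w)"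
      using Max_ge_iff[OF fin ne] by simp
  qed
  show ?thesis
    unfolding coherent_def by (metis (no_types, lifting) extrema)
qed

text \<open>
  A mixture of worlds that makes every bet in \<open>J\<close> fair has expected gain 0 for all stakes, so the
  gain cannot be negative at all of its worlds. The weights need not be normalised.
\<close>

lemma no_sure_loss_if_fair_mixture:
  fixes ws :: "(real \<times> 'w) list"
  assumes support: "\<forall>(l, w) \<in> set ws. 0 \<le> l \<and> w \<in> U"
    and nontrivial: "\<exists>(l, w) \<in> set ws. 0 < l"
    and fair: "\<And>j. j \<in> J \<Longrightarrow> (\<Sum>(l, w) \<leftarrow> ws.
        l * (indicator (antec (F ! j)) w * (indicator (conseq (F ! j)) w - P ! j))) = 0"
  shows "\<exists>w\<in>U. 0 \<le> gain F P J s w"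
proof (rule ccontr)
  assume "\<not> ?thesis"
  then have neg: "gain F P J s w < 0" if "w \<in> U" for w
    using that by force
  let ?b = "\<lambda>j w. indicator (antec (F ! j)) w * (indicator (conseq (F ! j)) w - P ! j)"
  have "(\<Sum>(l, w) \<leftarrow> vs. l * gain F P J s w) = (\<Sum>j\<in>J. s j * (\<Sum>(l, w) \<leftarrow> vs. l * ?b j w))"
    for vs :: "(real \<times> 'w) list"
  proof (induction vs)
    case Nil
    then show ?case by simp
  next
    case (Cons v vs)
    have "fst v * gain F P J s (snd v) = (\<Sum>j\<in>J. s j * (fst v * ?b j (snd v)))"
      unfolding gain_def sum_distrib_left by (rule sum.cong) (simp_all add: mult_ac)
    then show ?case
      using Cons.IH by (simp add: case_prod_unfold distrib_left sum.distrib)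
  qed
  then have zero: "(\<Sum>(l, w) \<leftarrow> ws. l * gain F P J s w) = 0"
    using fair by simp
  have terms: "0 \<le> - (l * gain F P J s w)" if "(l, w) \<in> set ws" for l w
    using that support neg[of w] by (auto simp: mult_nonneg_nonpos)
  have "l * gain F P J s w = 0" if "(l, w) \<in> set ws" for l w
  proof -
    have "sum_list (map (\<lambda>(l, w). - (l * gain F P J s w)) ws) = 0"
      using zero by (simp add: case_prod_unfold flip: uminus_sum_list_map[unfolded comp_def])
    then have "\<forall>r \<in> set (map (\<lambda>(l, w). - (l * gain F P J s w)) ws). r = 0"
      by (subst (asm) sum_list_nonneg_eq_0_iff) (use terms in auto)
    then show ?thesis
      using that by force
  qed
  moreover obtain l w where "(l, w) \<in> set ws" "0 < l"
    using nontrivial by auto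
  ultimately show False
    using support neg[of w] by fastforce
qed

section \<open>The conjunction and the iterated conditional\<close>

text \<open>
  Each single bet bounds its own prevision, and \<open>z \<le> x * y\<close> comes from a sure loss that
  combines the bets. Only worlds where some bet is on count towards a sure loss, so leaving out
  the bet on A|H also removes the worlds of AH outside K.
\<close>

lemma bounds_if_coherent:
  fixes x y z :: real
  assumes "coherent [Cond A H, iter_dF (Cond B K) (Cond A H), conj_K (Cond A H) (Cond B K)] [x, y, z]"
    (is "coherent ?F ?P")
  shows "0 \<le> x" "x \<le> 1" "0 \<le> y" "y \<le> 1" "0 \<le> z" "z \<le> x * y"
proof -
  have no_loss: "\<exists>w \<in> (\<Union>j\<in>J. antec (?F ! j)). 0 \<le> gain ?F ?P J s w"
    if "J \<noteq> {}" "J \<subseteq> {0, 1, 2}" for J s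
  proof -
    have "J \<subseteq> {..<length ?F}"
      using that by auto
    with that show ?thesis
      using assms unfolding coherent_iff_no_sure_loss by blast
  qed
  note gain_simps = gain_def indicator_def of_bool_def
  show x: "0 \<le> x" "x \<le> 1"
    using no_loss[of "{0}" "\<lambda>_. - 1"] no_loss[of "{0}" "\<lambda>_. 1"]
    by (auto simp: gain_simps split: if_splits)
  show y: "0 \<le> y" "y \<le> 1"
    using no_loss[of "{1}" "\<lambda>_. - 1"] no_loss[of "{1}" "\<lambda>_. 1"]
    by (auto simp: gain_simps split: if_splits)
  show z: "0 \<le> z"
    using no_loss[of "{2}" "\<lambda>_. - 1"]
    by (auto simp: gain_simps split: if_splits)
  show "z \<le> x * y"
  proof (rule ccontr)
    assume "\<not> z \<le> x * y"
    then have gap: "x * y < z" by simp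
    have xy: "0 \<le> x * y"
      using x y by simp
    show False
    proof (cases "x = 1")
      case True
      define s where "s j = (if j = (2::nat) then 1 else - 1 :: real)" for j
      have "\<exists>w \<in> (\<Union>j\<in>{1, 2}. antec (?F ! j)). 0 \<le> gain ?F ?P {1, 2} s w"
        by (rule no_loss) auto
      then show False
        using gap xy y True by (auto simp: gain_simps s_def split: if_splits)
    next
      case False
      \<comment> \<open>The extra stake \<open>e\<close> makes the gain negative on AH outside K; outside A but inside H it
        costs \<open>e * x\<close>, at most half of the gap.\<close>
      define e where "e = (z - x * y) / 2"
      have e: "0 < e" and ex: "e * x \<le> e"
        using gap x mult_left_mono[of x 1 e] by (auto simp: e_def)
      have margin: "x * y + e < z"
        using gap by (simp add: e_def field_simps)
      have "0 < (y + e) * (1 - x)"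
        using x y e False by (intro mult_pos_pos) auto
      then have void: "0 < y + e - x * y - e * x"
        by (simp add: algebra_simps)
      define s where "s j = (if j = (0::nat) then - (y + e) else if j = 1 then - 1 else 1)" for j
      have "\<exists>w \<in> (\<Union>j\<in>{0, 1, 2}. antec (?F ! j)). 0 \<le> gain ?F ?P {0, 1, 2} s w"
        by (rule no_loss) auto
      then obtain w where on: "w \<in> (\<Union>j\<in>{0, 1, 2}. antec (?F ! j))"
        and nonneg: "0 \<le> gain ?F ?P {0, 1, 2} s w"
        by (rule bexE)
      have gain: "gain ?F ?P {0, 1, 2} s w =
          - (y + e) * indicator H w * (indicator A w - x)
          - indicator (A \<inter> H \<inter> K) w * (indicator B w - y)
          + indicator (H \<inter> K \<union> - A \<inter> H \<union> - B \<inter> K) w * (indicator (A \<inter> H \<inter> B \<inter> K) w - z)"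
        by (simp add: gain_def s_def)
      consider "w \<in> A" "w \<in> H" "w \<in> K" | "w \<in> A" "w \<in> H" "w \<notin> K"
        | "w \<notin> A" "w \<in> H" | "w \<notin> H" "w \<notin> B" "w \<in> K"
        using on by auto
      then show False
      proof cases
        case 1
        then show False
          using nonneg margin ex e unfolding gain by (cases "w \<in> B") (simp_all add: algebra_simps)
      next
        case 2
        then show False
          using nonneg void unfolding gain by (simp add: algebra_simps)
      next
        case 3
        then show False
          using nonneg margin ex unfolding gain by (simp add: algebra_simps)
      next
        case 4
        then show False
          using nonneg gap xy unfolding gain by simp
      qed
    qed
  qed
qed

text \<open>
  The fair mixture depends on which bets are placed: its worlds must lie in the disjunction of
  the conditioning events that occur.
\<close>

lemma coherent_if_bounds:
  fixes x y z :: real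
  assumes indep: "logically_independent4 A B H K"
    and x: "0 \<le> x" "x \<le> 1" and y: "0 \<le> y" "y \<le> 1" and z: "0 \<le> z" "z \<le> x * y"
  shows "coherent [Cond A H, iter_dF (Cond B K) (Cond A H), conj_K (Cond A H) (Cond B K)] [x, y, z]"
    (is "coherent ?F ?P")
proof -
  have "A \<inter> B \<inter> H \<inter> K \<noteq> {}" "A \<inter> - B \<inter> H \<inter> K \<noteq> {}"
    "- A \<inter> B \<inter> H \<inter> K \<noteq> {}" "A \<inter> - B \<inter> - H \<inter> K \<noteq> {}"
    using indep unfolding logically_independent4_def by blast+
  then obtain w\<^sub>1 w\<^sub>2 w\<^sub>3 w\<^sub>4 where worlds:
    "w\<^sub>1 \<in> A" "w\<^sub>1 \<in> B" "w\<^sub>1 \<in> H" "w\<^sub>1 \<in> K"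
    "w\<^sub>2 \<in> A" "w\<^sub>2 \<notin> B" "w\<^sub>2 \<in> H" "w\<^sub>2 \<in> K"
    "w\<^sub>3 \<notin> A" "w\<^sub>3 \<in> H"
    "w\<^sub>4 \<notin> B" "w\<^sub>4 \<notin> H" "w\<^sub>4 \<in> K"
    by blast
  have prod_bounds: "0 \<le> x * y" "0 \<le> x * (1 - y)"
    using x y by simp_all
  have no_loss: "\<exists>w \<in> (\<Union>j\<in>J. antec (?F ! j)). 0 \<le> gain ?F ?P J s w"
    if J: "J \<noteq> {}" "J \<subseteq> {0, 1, 2}" for J s
  proof -
    consider (conj_null) "2 \<in> J" "z = 0" | (conj_pos) "2 \<in> J" "0 < z"
      | (cond) "2 \<notin> J" "0 \<in> J" | (iter) "J = {1}"
      using J z by (cases "2 \<in> J"; cases "0 \<in> J"; cases "z = 0") auto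
    then show ?thesis
    proof cases
      case conj_null
      show ?thesis
        by (rule no_sure_loss_if_fair_mixture[where ws = "[(1, w\<^sub>4)]"])
          (use conj_null J worlds in \<open>auto 0 3 intro!: bexI[of _ 2]\<close>)
    next
      case conj_pos
      \<comment> \<open>The mixture has total weight \<open>x * y / z\<close>, so the weight \<open>x * y\<close> of the conjunction is
        the fraction \<open>z\<close> of it.\<close>
      show ?thesis
      proof (rule no_sure_loss_if_fair_mixture
          [where ws = "[(x * y, w\<^sub>1), (x * (1 - y), w\<^sub>2), (1 - x, w\<^sub>3), (x * y / z - 1, w\<^sub>4)]"])
        show "\<forall>(l, w) \<in> set [(x * y, w\<^sub>1), (x * (1 - y), w\<^sub>2), (1 - x, w\<^sub>3), (x * y / z - 1, w\<^sub>4)].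
            0 \<le> l \<and> w \<in> (\<Union>j\<in>J. antec (?F ! j))"
          using conj_pos worlds prod_bounds x z by (auto intro!: bexI[of _ 2])
        show "\<exists>(l, w) \<in> set [(x * y, w\<^sub>1), (x * (1 - y), w\<^sub>2), (1 - x, w\<^sub>3), (x * y / z - 1, w\<^sub>4)].
            0 < l"
          using conj_pos z by auto
      next
        fix j assume "j \<in> J"
        then consider "j = 0" | "j = 1" | "j = 2"
          using J by blast
        then show "(\<Sum>(l, w) \<leftarrow> [(x * y, w\<^sub>1), (x * (1 - y), w\<^sub>2), (1 - x, w\<^sub>3), (x * y / z - 1, w\<^sub>4)].
            l * (indicator (antec (?F ! j)) w * (indicator (conseq (?F ! j)) w - ?P ! j))) = 0"
          by cases (use worlds conj_pos in \<open>simp_all add: field_simps\<close>)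
      qed
    next
      case cond
      show ?thesis
      proof (rule no_sure_loss_if_fair_mixture
          [where ws = "[(x * y, w\<^sub>1), (x * (1 - y), w\<^sub>2), (1 - x, w\<^sub>3)]"])
        show "\<forall>(l, w) \<in> set [(x * y, w\<^sub>1), (x * (1 - y), w\<^sub>2), (1 - x, w\<^sub>3)].
            0 \<le> l \<and> w \<in> (\<Union>j\<in>J. antec (?F ! j))"
          using cond worlds prod_bounds x by (auto intro!: bexI[of _ 0])
        have "x * y + x * (1 - y) + (1 - x) = 1"
          by (simp add: algebra_simps)
        then have "0 < x * y \<or> 0 < x * (1 - y) \<or> 0 < 1 - x"
          using prod_bounds x by linarith
        then show "\<exists>(l, w) \<in> set [(x * y, w\<^sub>1), (x * (1 - y), w\<^sub>2), (1 - x, w\<^sub>3)]. 0 < l"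
          by simp
      next
        fix j assume "j \<in> J"
        then consider "j = 0" | "j = 1"
          using J cond by blast
        then show "(\<Sum>(l, w) \<leftarrow> [(x * y, w\<^sub>1), (x * (1 - y), w\<^sub>2), (1 - x, w\<^sub>3)].
            l * (indicator (antec (?F ! j)) w * (indicator (conseq (?F ! j)) w - ?P ! j))) = 0"
          by cases (use worlds in \<open>simp_all add: algebra_simps\<close>)
      qed
    next
      case iter
      show ?thesis
        by (rule no_sure_loss_if_fair_mixture[where ws = "[(y, w\<^sub>1), (1 - y, w\<^sub>2)]"])
          (use iter worlds y in \<open>auto simp: algebra_simps\<close>)
    qed
  qed
  have "antec (?F ! j) \<noteq> {}" if "j < length ?F" for j
  proof -
    have "j = 0 \<or> j = 1 \<or> j = 2"
      using that by auto
    then show ?thesis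
      using worlds by auto
  qed
  moreover have "J \<subseteq> {0, 1, 2}" if "J \<subseteq> {..<length ?F}" for J
  proof
    fix j assume "j \<in> J"
    with that have "j < 3" by auto
    then show "j \<in> {0, 1, 2}" by auto
  qed
  ultimately show ?thesis
    unfolding coherent_iff_no_sure_loss
    by (intro conjI allI impI no_loss) simp_all
qed

theorem theorem6:
  fixes A B H K :: "'w event" and x y z :: real
  assumes "logically_independent4 A B H K"
  shows "coherent [Cond A H, iter_dF (Cond B K) (Cond A H), conj_K (Cond A H) (Cond B K)] [x, y, z]
    \<longleftrightarrow> (x, y) \<in> {0..1} \<times> {0..1} \<and> z \<in> {0..x * y}"
  using bounds_if_coherent[of A H B K x y z] coherent_if_bounds[OF assms, of x y z] by auto

end
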